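(* For every $d\ge1$, $a_d(5)\equiv1+5\bigl(2^{d-1}+4^{d-1}\bigr)\pmod{25}$. Consequently, $\nu_5(a_d(5)-1)=1$ if and only if $d\not\equiv3\pmod4$.
   Context: For integers $d,n\ge1$, $T_d(n)$ is the Cayley graph of $(\mathbb{Z}/n\mathbb{Z})^d$ with respect to $\{\pm e_1,\dots,\pm e_d\}\setminus\{0\}$ ($e_i$ the standard basis vectors); it is a simple graph. $a_d(n)$ is the number of independent sets of $T_d(n)$ (including the empty set). $\nu_5$ is the $5$-adic valuation with $\nu_5(5)=1$. *)

theory Defs
  imports
    "HOL-Algebra.Elementary_Groups"
    "HOL-Algebra.Product_Groups"
    "HOL-Number_Theory.Cong"
    "HOL-Computational_Algebra.Primes"
begin

text \<open>An undirected graph is given by a vertex set \<open>V\<close> and a set \<open>E\<close> of edges, each edge being the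
  set of its two endpoints.  In \<open>cayley_edges\<close> the connection set \<open>S\<close> is meant to be closed under
  inverses and not to contain the identity.\<close>

definition cayley_edges :: "('a, 'b) monoid_scheme \<Rightarrow> 'a set \<Rightarrow> 'a set set" where
  "cayley_edges G S = {{x, x \<otimes>\<^bsub>G\<^esub> s} | x s. x \<in> carrier G \<and> s \<in> S}"

definition independent_sets :: "'a set \<Rightarrow> 'a set set \<Rightarrow> 'a set set" where
  "independent_sets V E = {I. I \<subseteq> V \<and> (\<forall>e\<in>E. \<not> e \<subseteq> I)}"

definition torus_group :: "nat \<Rightarrow> nat \<Rightarrow> (nat \<Rightarrow> int) monoid" where
  "torus_group d n = product_group {1..d} (\<lambda>_. integer_mod_group n)"

text \<open>The entry \<open>1 mod int n\<close> is the class of 1 in \<open>integer_mod_group n\<close>, which is 0 if \<open>n = 1\<close>.\<close>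

definition basis_vec :: "nat \<Rightarrow> nat \<Rightarrow> nat \<Rightarrow> (nat \<Rightarrow> int)" where
  "basis_vec d n i = (\<lambda>j\<in>{1..d}. if j = i then 1 mod int n else 0)"

definition torus_gens :: "nat \<Rightarrow> nat \<Rightarrow> (nat \<Rightarrow> int) set" where
  "torus_gens d n =
     (basis_vec d n ` {1..d} \<union> (\<lambda>i. inv\<^bsub>torus_group d n\<^esub> (basis_vec d n i)) ` {1..d})
       - {\<one>\<^bsub>torus_group d n\<^esub>}"

definition torus_verts :: "nat \<Rightarrow> nat \<Rightarrow> (nat \<Rightarrow> int) set" where
  "torus_verts d n = carrier (torus_group d n)"

definition torus_edges :: "nat \<Rightarrow> nat \<Rightarrow> (nat \<Rightarrow> int) set set" where
  "torus_edges d n = cayley_edges (torus_group d n) (torus_gens d n)"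

definition num_indep :: "nat \<Rightarrow> nat \<Rightarrow> nat" where
  "num_indep d n = card (independent_sets (torus_verts d n) (torus_edges d n))"

end

theory Submission
  imports Defs "HOL-Algebra.Group_Action"
begin

text \<open>The translation action of the \<open>p\<close>-group \<open>(\<int>/p)\<^sup>d\<close> on independent sets has orbits of \<open>p\<close>-power
  size, so modulo \<open>p\<^sup>2\<close> only the sets with at most \<open>p\<close> translates count.  If \<open>I\<close> is such a set and
  is nonempty, its translates by the multiples of \<open>e\<^sub>1\<close> are distinct and hence exhaust its orbit, so
  \<open>I + e\<^sub>i = I + c\<^sub>i e\<^sub>1\<close> for unique \<open>c\<^sub>i \<noteq> 0\<close> with \<open>c\<^sub>1 = 1\<close>.  Thus \<open>I = {x. (\<Sum>\<^sub>i c\<^sub>i x\<^sub>i) mod p \<in> A}\<close>, where \<open>A\<close> is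
  a nonempty independent set of the circulant graph on \<open>\<int>/p\<close> with connection set \<open>{\<plusminus>c\<^sub>i}\<close>.  For
  \<open>p = 5\<close> this graph is the 5-cycle (10 choices of \<open>A\<close>) for the \<open>2\<^bsup>d-1\<^esup>\<close> tuples with all \<open>c\<^sub>i = \<plusminus>1\<close>,
  and complete (5 choices) for the other \<open>4\<^bsup>d-1\<^esup> - 2\<^bsup>d-1\<^esup>\<close> tuples.\<close>

section \<open>Translation actions and orbit counting modulo the square of a prime\<close>

lemma (in group) mem_l_coset_iff:
  assumes "I \<subseteq> carrier G" "g \<in> carrier G" "x \<in> carrier G"
  shows "x \<in> g <# I \<longleftrightarrow> inv g \<otimes> x \<in> I"
proof
  assume "x \<in> g <# I"
  then obtain y where y: "y \<in> I" "x = g \<otimes> y" by (auto simp: l_coset_def)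
  then have "y \<in> carrier G" using assms by blast
  then show "inv g \<otimes> x \<in> I"
    using y assms by (simp add: m_assoc[symmetric])
next
  assume "inv g \<otimes> x \<in> I"
  moreover have "x = g \<otimes> (inv g \<otimes> x)"
    using assms by (simp add: m_assoc[symmetric])
  ultimately show "x \<in> g <# I" by (auto simp: l_coset_def)
qed

lemma (in group) group_action_l_coset:
  assumes E: "E \<subseteq> Pow (carrier G)"
    and closed: "\<And>g I. g \<in> carrier G \<Longrightarrow> I \<in> E \<Longrightarrow> g <#\<^bsub>G\<^esub> I \<in> E"
  shows "group_action G E (\<lambda>g. \<lambda>I\<in>E. g <#\<^bsub>G\<^esub> I)"
proof -
  have cancel: "inv g <#\<^bsub>G\<^esub> (g <#\<^bsub>G\<^esub> I) = I" "g <#\<^bsub>G\<^esub> (inv g <#\<^bsub>G\<^esub> I) = I" if "g \<in> carrier G" "I \<in> E" for g I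
    using that E by (auto simp: lcos_m_assoc lcos_mult_one)
  have bij: "(\<lambda>I\<in>E. g <#\<^bsub>G\<^esub> I) \<in> Bij E" if "g \<in> carrier G" for g
    using that closed cancel
    by (auto simp: Bij_def intro!: bij_betwI[where g = "\<lambda>I. inv g <#\<^bsub>G\<^esub> I"])
  have "(\<lambda>g. \<lambda>I\<in>E. g <#\<^bsub>G\<^esub> I) \<in> hom G (BijGroup E)"
    using bij closed E
    by (auto simp: hom_def BijGroup_def compose_def lcos_m_assoc intro!: restrict_ext)
  then show ?thesis
    unfolding group_action_def group_hom_def group_hom_axioms_def
    by (simp add: group_BijGroup is_group)
qed

text \<open>By the orbit-stabilizer theorem every orbit size divides \<open>p ^ n\<close>, so it is
  a power of \<open>p\<close>. A size exceeding \<open>p\<close> is therefore divisible by the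
  square of \<open>p\<close>, and the union of the large orbits contributes nothing to the
  residue.\<close>

lemma (in group_action) card_cong_small_orbits:
  fixes p :: nat
  assumes p: "prime p" and ord: "order G = p ^ n" and fin: "finite E"
  shows "[card E = card {x \<in> E. card (orbit G \<phi> x) \<le> p}] (mod p\<^sup>2)"
proof -
  let ?B = "{x \<in> E. \<not> card (orbit G \<phi> x) \<le> p}"
  define C where "C = {Ob \<in> orbits G E \<phi>. \<not> card Ob \<le> p}"
  have UN: "\<Union>(orbits G E \<phi>) = E" and disj: "\<And>A B. A \<in> orbits G E \<phi> \<Longrightarrow> B \<in> orbits G E \<phi> \<Longrightarrow> A \<noteq> B \<Longrightarrow> A \<inter> B = {}"
    using orbits_coverture disjoint_union by blast+
  have orbit_eq: "orbit G \<phi> x = Ob" if "Ob \<in> orbits G E \<phi>" "x \<in> Ob" for x Ob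
  proof -
    have "x \<in> E" using that UN by blast
    then have "orbit G \<phi> x \<in> orbits G E \<phi>" "x \<in> orbit G \<phi> x"
      using orbit_refl by (auto simp: orbits_def)
    then show ?thesis using disj that by blast
  qed
  have UC: "\<Union>C = ?B"
  proof
    show "\<Union>C \<subseteq> ?B" using orbit_eq UN by (auto simp: C_def)
    show "?B \<subseteq> \<Union>C"
      using orbit_refl by (auto simp: C_def orbits_def)
  qed
  have "p\<^sup>2 dvd card (\<Union>C)"
  proof (rule dvd_partition)
    show "finite (\<Union>C)" using fin UC by simp
    show "\<forall>c\<in>C. p\<^sup>2 dvd card c"
    proof
      fix c assume "c \<in> C"
      then obtain x where x: "x \<in> E" "c = orbit G \<phi> x" and big: "\<not> card c \<le> p"
        by (auto simp: C_def orbits_def)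
      have "card c dvd p ^ n"
        using orbit_stabilizer_theorem[OF x(1)] x(2) ord by (metis dvd_triv_left)
      then obtain k where k: "card c = p ^ k"
        using p by (auto simp: divides_primepow_nat)
      have "2 \<le> k"
      proof (rule ccontr)
        assume "\<not> 2 \<le> k"
        then have "k = 0 \<or> k = 1" by auto
        then show False using big k prime_ge_1_nat[OF p] by auto
      qed
      then show "p\<^sup>2 dvd card c" using k by (simp add: le_imp_power_dvd)
    qed
    show "\<forall>c1\<in>C. \<forall>c2\<in>C. c1 \<noteq> c2 \<longrightarrow> c1 \<inter> c2 = {}"
      using disj by (auto simp: C_def)
  qed
  then have dvdB: "p\<^sup>2 dvd card ?B" using UC by simp
  have "card E = card {x \<in> E. card (orbit G \<phi> x) \<le> p} + card ?B"
    using fin by (subst card_Un_disjoint[symmetric]) (auto intro!: arg_cong[where f = card])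
  then show ?thesis using dvdB by (simp add: cong_def mod_add_right_eq[symmetric] dvd_eq_mod_eq_0)
qed

section \<open>Arithmetic in the torus group through integer representatives\<close>

text \<open>Vertices are handled through integer vectors \<open>v\<close> with reduction \<open>torus_red d n v\<close>, which lets all
  group computations take place in \<open>\<int>\<close>.\<close>

definition torus_red :: "nat \<Rightarrow> nat \<Rightarrow> (nat \<Rightarrow> int) \<Rightarrow> nat \<Rightarrow> int" where
  "torus_red d n v = (\<lambda>j\<in>{1..d}. v j mod int n)"

lemma group_torus_group: "group (torus_group d n)"
  by (simp add: torus_group_def)

lemma torus_verts_eq: "n > 0 \<Longrightarrow> torus_verts d n = {1..d} \<rightarrow>\<^sub>E {0..<int n}"
  by (simp add: torus_verts_def torus_group_def carrier_integer_mod_group)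

lemma torus_red_in_verts [simp]: "n > 0 \<Longrightarrow> torus_red d n v \<in> torus_verts d n"
  by (auto simp: torus_verts_eq torus_red_def)

lemma torus_red_in_carrier [simp]: "n > 0 \<Longrightarrow> torus_red d n v \<in> carrier (torus_group d n)"
  using torus_red_in_verts by (simp add: torus_verts_def)

lemma torus_red_id: "n > 0 \<Longrightarrow> x \<in> torus_verts d n \<Longrightarrow> torus_red d n x = x"
  by (auto simp: torus_verts_eq torus_red_def PiE_iff extensional_def fun_eq_iff)

lemma torus_red_eqI:
  "(\<And>j. j \<in> {1..d} \<Longrightarrow> [v j = w j] (mod int n)) \<Longrightarrow> torus_red d n v = torus_red d n w"
  by (auto simp: torus_red_def cong_def intro!: restrict_ext)

lemma torus_red_add:
  "torus_red d n v \<otimes>\<^bsub>torus_group d n\<^esub> torus_red d n w = torus_red d n (\<lambda>j. v j + w j)"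
  by (auto simp: torus_red_def torus_group_def mod_simps intro!: restrict_ext)

lemma torus_red_inv:
  assumes "n > 0"
  shows "inv\<^bsub>torus_group d n\<^esub> (torus_red d n v) = torus_red d n (\<lambda>j. - v j)"
  using assms
  by (auto simp: torus_red_def torus_group_def carrier_integer_mod_group mod_simps intro!: restrict_ext)

lemma basis_vec_eq: "basis_vec d n i = torus_red d n (\<lambda>j. if j = i then 1 else 0)"
  by (auto simp: basis_vec_def torus_red_def intro!: restrict_ext)

lemma torus_red_upd:
  "torus_red d n v \<otimes>\<^bsub>torus_group d n\<^esub> basis_vec d n i = torus_red d n (v(i := v i + 1))"
  by (auto simp: basis_vec_eq torus_red_add intro!: torus_red_eqI)

section \<open>Independent sets of the torus and their translates\<close>

abbreviation torus_indep :: "nat \<Rightarrow> nat \<Rightarrow> (nat \<Rightarrow> int) set set" where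
  "torus_indep d n \<equiv> independent_sets (torus_verts d n) (torus_edges d n)"

text \<open>Only the positive generators have to be tested: an edge from \<open>x\<close> to x - e_i
  is also the edge from y = x - e_i to y + e_i. The bound \<open>n \<ge> 2\<close> ensures that e_i
  is not the identity, which \<open>torus_gens\<close> removes.\<close>

lemma torus_indep_iff:
  assumes n: "n \<ge> 2"
  shows "I \<in> torus_indep d n \<longleftrightarrow> I \<subseteq> torus_verts d n \<and>
    (\<forall>v. \<forall>i\<in>{1..d}. torus_red d n v \<in> I \<longrightarrow> torus_red d n (v(i := v i + 1)) \<notin> I)"
proof -
  interpret G: group "torus_group d n" by (rule group_torus_group)
  let ?G = "torus_group d n"
  have n0: "n > 0" using n by simp
  have bc: "basis_vec d n i \<in> carrier ?G" for i using n0 by (simp add: basis_vec_eq)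
  have gen: "basis_vec d n i \<in> torus_gens d n" if "i \<in> {1..d}" for i
  proof -
    have "basis_vec d n i i \<noteq> \<one>\<^bsub>?G\<^esub> i" using that n by (simp add: basis_vec_def torus_group_def)
    then show ?thesis using that by (auto simp: torus_gens_def)
  qed
  show ?thesis
  proof (intro iffI conjI allI ballI impI)
    assume I: "I \<in> torus_indep d n"
    show "I \<subseteq> torus_verts d n" using I by (simp add: independent_sets_def)
    fix v i assume i: "i \<in> {1..d}" and v: "torus_red d n v \<in> I"
    have "{torus_red d n v, torus_red d n v \<otimes>\<^bsub>?G\<^esub> basis_vec d n i} \<in> torus_edges d n"
      unfolding torus_edges_def cayley_edges_def using gen[OF i] torus_red_in_carrier[OF n0] by blast
    then show "torus_red d n (v(i := v i + 1)) \<notin> I"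
      using I v by (auto simp: independent_sets_def torus_red_upd)
  next
    assume R: "I \<subseteq> torus_verts d n \<and>
      (\<forall>v. \<forall>i\<in>{1..d}. torus_red d n v \<in> I \<longrightarrow> torus_red d n (v(i := v i + 1)) \<notin> I)"
    have key: "x \<otimes>\<^bsub>?G\<^esub> basis_vec d n i \<notin> I" if "x \<in> I" "i \<in> {1..d}" for x i
    proof -
      have "torus_red d n x = x" using that R n0 torus_red_id by blast
      then show ?thesis using that R torus_red_upd[of d n x i] by metis
    qed
    have "\<not> e \<subseteq> I" if e: "e \<in> torus_edges d n" for e
    proof
      assume eI: "e \<subseteq> I"
      from e obtain x s where x: "x \<in> carrier ?G" "s \<in> torus_gens d n" "e = {x, x \<otimes>\<^bsub>?G\<^esub> s}"
        by (auto simp: torus_edges_def cayley_edges_def)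
      from x(2) obtain i where i: "i \<in> {1..d}"
        and s: "s = basis_vec d n i \<or> s = inv\<^bsub>?G\<^esub> (basis_vec d n i)"
        by (auto simp: torus_gens_def)
      from s show False
      proof
        assume "s = basis_vec d n i"
        then show False using key[OF _ i, of x] eI x by auto
      next
        assume s: "s = inv\<^bsub>?G\<^esub> (basis_vec d n i)"
        then have "(x \<otimes>\<^bsub>?G\<^esub> s) \<otimes>\<^bsub>?G\<^esub> basis_vec d n i = x"
          using x(1) bc by (simp add: G.m_assoc)
        then show False using key[OF _ i, of "x \<otimes>\<^bsub>?G\<^esub> s"] eI x by auto
      qed
    qed
    then show "I \<in> torus_indep d n" using R by (auto simp: independent_sets_def)
  qed
qed

lemma torus_indepD:
  "n \<ge> 2 \<Longrightarrow> I \<in> torus_indep d n \<Longrightarrow> i \<in> {1..d} \<Longrightarrow> torus_red d n v \<in> I \<Longrightarrow>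
    torus_red d n (v(i := v i + 1)) \<notin> I"
  by (simp add: torus_indep_iff del: atLeastAtMost_iff)

definition torus_shift :: "nat \<Rightarrow> nat \<Rightarrow> (nat \<Rightarrow> int) \<Rightarrow> (nat \<Rightarrow> int) set \<Rightarrow> (nat \<Rightarrow> int) set" where
  "torus_shift d n v I = torus_red d n v <#\<^bsub>torus_group d n\<^esub> I"

lemma torus_red_mem_shift_iff:
  assumes "n > 0" "I \<subseteq> torus_verts d n"
  shows "torus_red d n v \<in> torus_shift d n w I \<longleftrightarrow> torus_red d n (\<lambda>j. v j - w j) \<in> I"
proof -
  interpret G: group "torus_group d n" by (rule group_torus_group)
  show ?thesis using assms
    by (simp add: torus_shift_def G.mem_l_coset_iff torus_verts_def torus_red_inv torus_red_add)
qed

lemma torus_shift_subset: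
  assumes "n > 0" "I \<subseteq> torus_verts d n"
  shows "torus_shift d n w I \<subseteq> torus_verts d n"
proof -
  interpret G: group "torus_group d n" by (rule group_torus_group)
  show ?thesis using assms G.l_coset_subset_G by (simp add: torus_shift_def torus_verts_def)
qed

lemma torus_shift_add:
  assumes "n > 0" "I \<subseteq> torus_verts d n"
  shows "torus_shift d n v (torus_shift d n w I) = torus_shift d n (\<lambda>j. v j + w j) I"
proof -
  interpret G: group "torus_group d n" by (rule group_torus_group)
  show ?thesis using assms
    by (simp add: torus_shift_def torus_verts_def G.lcos_m_assoc torus_red_add)
qed

lemma torus_shift_cong:
  "(\<And>j. j \<in> {1..d} \<Longrightarrow> [v j = w j] (mod int n)) \<Longrightarrow> torus_shift d n v I = torus_shift d n w I"
  using torus_red_eqI[of d v w n] by (simp add: torus_shift_def)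

text \<open>Every vertex is its own reduction, so sets of vertices can be compared on reductions of
  arbitrary integer vectors.\<close>

lemma torus_set_eqI:
  assumes "n > 0" "I \<subseteq> torus_verts d n" "J \<subseteq> torus_verts d n"
    and "\<And>v. torus_red d n v \<in> I \<longleftrightarrow> torus_red d n v \<in> J"
  shows "I = J"
  using assms torus_red_id by (metis subsetD subsetI subset_antisym)

lemma torus_shift_zero:
  assumes "n > 0" "I \<subseteq> torus_verts d n"
  shows "torus_shift d n (\<lambda>j. 0) I = I"
  using assms by (intro torus_set_eqI[of n _ d]) (simp_all add: torus_shift_subset torus_red_mem_shift_iff)

lemma torus_shift_indep:
  assumes n: "n \<ge> 2" and I: "I \<in> torus_indep d n"
  shows "torus_shift d n w I \<in> torus_indep d n"
proof -
  have n0: "n > 0" and sub: "I \<subseteq> torus_verts d n" using assms by (auto simp: torus_indep_iff)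
  have "torus_red d n (v(i := v i + 1)) \<notin> torus_shift d n w I"
    if i: "i \<in> {1..d}" and v: "torus_red d n v \<in> torus_shift d n w I" for v i
  proof -
    have "(\<lambda>j. (v(i := v i + 1)) j - w j) = (\<lambda>j. v j - w j)(i := (v i - w i) + 1)" by auto
    then show ?thesis
      using torus_indepD[OF n I i, of "\<lambda>j. v j - w j"] v
      unfolding torus_red_mem_shift_iff[OF n0 sub] by simp
  qed
  then show ?thesis using n torus_shift_subset[OF n0 sub] by (simp add: torus_indep_iff)
qed

lemma finite_torus_verts: "n > 0 \<Longrightarrow> finite (torus_verts d n)"
  by (simp add: torus_verts_eq finite_PiE)

lemma card_torus_verts: "n > 0 \<Longrightarrow> card (torus_verts d n) = n ^ d"
  by (simp add: torus_verts_eq card_PiE)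

lemma finite_torus_indep: "n > 0 \<Longrightarrow> finite (torus_indep d n)"
  using finite_torus_verts by (auto simp: independent_sets_def intro: finite_subset[of _ "Pow (torus_verts d n)"])

section \<open>Reduction to independent sets with few translates\<close>

text \<open>The range over all integer vectors is the orbit of \<open>I\<close> under translation.
  The empty set, a fixed point, is left out because it is not described by a unique pair of a linear
  form and a residue set; it is the summand 1 in \<open>num_indep_cong_small_indep\<close>.\<close>

definition small_indep :: "nat \<Rightarrow> nat \<Rightarrow> (nat \<Rightarrow> int) set set" where
  "small_indep d p = {I \<in> torus_indep d p. I \<noteq> {} \<and> card (range (\<lambda>w. torus_shift d p w I)) \<le> p}"

lemma num_indep_cong_small_indep:
  assumes p: "prime p"
  shows "[num_indep d p = 1 + card (small_indep d p)] (mod p\<^sup>2)"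
proof -
  have p2: "p \<ge> 2" and p0: "p > 0" using prime_ge_2_nat[OF p] by auto
  let ?G = "torus_group d p" and ?E = "torus_indep d p"
  interpret G: group ?G by (rule group_torus_group)
  let ?\<phi> = "\<lambda>g. \<lambda>I\<in>?E. g <#\<^bsub>?G\<^esub> I"
  have shift: "g <#\<^bsub>?G\<^esub> I = torus_shift d p g I" if "g \<in> carrier ?G" for g I
    using torus_red_id[OF p0, of g d] that by (simp add: torus_shift_def torus_verts_def)
  interpret A: group_action ?G ?E ?\<phi>
  proof (rule G.group_action_l_coset)
    show "?E \<subseteq> Pow (carrier ?G)" by (auto simp: independent_sets_def torus_verts_def)
    show "g <#\<^bsub>?G\<^esub> I \<in> ?E" if "g \<in> carrier ?G" "I \<in> ?E" for g I
      using that shift torus_shift_indep[OF p2] by simp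
  qed
  have orb: "orbit ?G ?\<phi> I = range (\<lambda>w. torus_shift d p w I)" if "I \<in> ?E" for I
  proof -
    have "torus_shift d p w I = ?\<phi> (torus_red d p w) I" "torus_red d p w \<in> carrier ?G" for w
      using that p0 by (simp_all add: torus_shift_def)
    then have "range (\<lambda>w. torus_shift d p w I) \<subseteq> orbit ?G ?\<phi> I"
      unfolding orbit_def by blast
    moreover have "orbit ?G ?\<phi> I \<subseteq> range (\<lambda>w. torus_shift d p w I)"
      using that shift by (auto simp: orbit_def)
    ultimately show ?thesis by blast
  qed
  have empty: "{} \<in> ?E" by (auto simp: independent_sets_def torus_edges_def cayley_edges_def)
  have empty_orb: "range (\<lambda>w. torus_shift d p w {}) = {{}}"
    by (auto simp: torus_shift_def l_coset_def)
  have "{I \<in> ?E. card (orbit ?G ?\<phi> I) \<le> p} = {I \<in> ?E. card (range (\<lambda>w. torus_shift d p w I)) \<le> p}"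
    using orb by auto
  also have "\<dots> = insert {} (small_indep d p)"
    using empty empty_orb p0 by (auto simp: small_indep_def)
  finally have "card {I \<in> ?E. card (orbit ?G ?\<phi> I) \<le> p} = 1 + card (small_indep d p)"
    using finite_torus_indep[OF p0] by (simp add: small_indep_def)
  moreover have "order ?G = p ^ d"
    using card_torus_verts[OF p0] by (simp add: order_def torus_verts_def)
  ultimately show ?thesis
    using A.card_cong_small_orbits[OF p _ finite_torus_indep[OF p0]] by (simp add: num_indep_def)
qed

section \<open>Level sets of linear forms and circulant graphs\<close>

definition torus_level :: "nat \<Rightarrow> nat \<Rightarrow> (nat \<Rightarrow> int) \<Rightarrow> int set \<Rightarrow> (nat \<Rightarrow> int) set" where
  "torus_level d n c A = {x \<in> torus_verts d n. (\<Sum>i\<in>{1..d}. c i * x i) mod int n \<in> A}"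

text \<open>Scaling \<open>c\<close> and \<open>A\<close> by the same unit modulo \<open>n\<close>
  leaves the level set unchanged; \<open>c 1 = 1\<close> fixes the scale. A coefficient 0 is
  excluded since the level set would then be invariant under e_i, which no nonempty independent set
  is.\<close>

definition torus_coeffs :: "nat \<Rightarrow> nat \<Rightarrow> (nat \<Rightarrow> int) set" where
  "torus_coeffs d n = {c \<in> {1..d} \<rightarrow>\<^sub>E {1..<int n}. c 1 = 1}"

text \<open>These are the nonempty independent sets of the circulant graph with connections
  \<open>s\<close> and \<open>-s\<close> for \<open>s\<close> in \<open>S\<close>; testing
  \<open>a + s\<close> for all \<open>a\<close> in \<open>A\<close> covers both signs.\<close>

definition circulant_indep :: "nat \<Rightarrow> int set \<Rightarrow> int set set" where
  "circulant_indep n S =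
    {A. A \<subseteq> {0..<int n} \<and> A \<noteq> {} \<and> (\<forall>s\<in>S. \<forall>a\<in>A. (a + s) mod int n \<notin> A)}"

abbreviation axis :: "nat \<Rightarrow> int \<Rightarrow> nat \<Rightarrow> int" where
  "axis i k \<equiv> \<lambda>j. if j = i then k else 0"

lemma sum_mult_axis:
  assumes "i \<in> {1..d::nat}"
  shows "(\<Sum>j\<in>{1..d}. c j * axis i k j) = c i * k"
proof -
  have "(\<Sum>j\<in>{1..d}. c j * axis i k j) = (\<Sum>j\<in>{1..d}. if j = i then c j * k else 0)"
    by (intro sum.cong) auto
  then show ?thesis using assms by simp
qed

lemma torus_level_subset: "torus_level d n c A \<subseteq> torus_verts d n"
  by (auto simp: torus_level_def)

lemma torus_red_mem_level_iff:
  assumes "n > 0"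
  shows "torus_red d n v \<in> torus_level d n c A \<longleftrightarrow> (\<Sum>i\<in>{1..d}. c i * v i) mod int n \<in> A"
proof -
  have "(\<Sum>i\<in>{1..d}. c i * torus_red d n v i) = (\<Sum>i\<in>{1..d}. c i * (v i mod int n))"
    by (intro sum.cong) (auto simp: torus_red_def)
  also have "\<dots> mod int n = (\<Sum>i\<in>{1..d}. c i * (v i mod int n) mod int n) mod int n"
    by (simp only: mod_sum_eq)
  also have "\<dots> = (\<Sum>i\<in>{1..d}. c i * v i) mod int n"
    by (simp only: mod_mult_right_eq mod_sum_eq)
  finally show ?thesis using assms by (simp add: torus_level_def)
qed

lemma torus_red_axis_mem_level_iff:
  assumes "n > 0" "i \<in> {1..d}"
  shows "torus_red d n (axis i k) \<in> torus_level d n c A \<longleftrightarrow> (c i * k) mod int n \<in> A"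
  unfolding torus_red_mem_level_iff[OF assms(1)] sum_mult_axis[OF assms(2)] ..

text \<open>A step along e_i changes the value of the form by \<open>c i\<close>. Conversely every
  residue is a value of the form, attained on the first axis because \<open>c 1 = 1\<close>.\<close>

lemma torus_level_indep_iff:
  assumes n: "n \<ge> 2" and d: "d \<ge> 1" and A: "A \<subseteq> {0..<int n}" and c1: "c 1 = 1"
  shows "torus_level d n c A \<in> torus_indep d n \<longleftrightarrow>
    (\<forall>s\<in>c ` {1..d}. \<forall>a\<in>A. (a + s) mod int n \<notin> A)"
proof -
  have n0: "n > 0" using n by simp
  have one: "1 \<in> {1..d}" using d by simp
  have upd: "(\<Sum>j\<in>{1..d}. c j * (v(i := v i + 1)) j) = (\<Sum>j\<in>{1..d}. c j * v j) + c i"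
    if "i \<in> {1..d}" for i v
  proof -
    have "(\<Sum>j\<in>{1..d}. c j * (v(i := v i + 1)) j) = (\<Sum>j\<in>{1..d}. c j * v j + c j * axis i 1 j)"
      by (intro sum.cong) (auto simp: algebra_simps)
    then show ?thesis using sum_mult_axis[OF that, of c 1] by (simp add: sum.distrib)
  qed
  have iff: "torus_level d n c A \<in> torus_indep d n \<longleftrightarrow> (\<forall>v. \<forall>i\<in>{1..d}.
      (\<Sum>j\<in>{1..d}. c j * v j) mod int n \<in> A \<longrightarrow> ((\<Sum>j\<in>{1..d}. c j * v j) + c i) mod int n \<notin> A)"
    unfolding torus_indep_iff[OF n] torus_red_mem_level_iff[OF n0]
    using torus_level_subset upd by (metis (no_types, lifting))
  show ?thesis
  proof
    assume L: "torus_level d n c A \<in> torus_indep d n"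
    have "(a + c i) mod int n \<notin> A" if "a \<in> A" "i \<in> {1..d}" for a i
    proof -
      have "(\<Sum>j\<in>{1..d}. c j * axis 1 a j) = a" using sum_mult_axis[OF one, of c a] c1 by simp
      moreover have "a mod int n = a" using A that by auto
      ultimately show ?thesis using L that unfolding iff by metis
    qed
    then show "\<forall>s\<in>c ` {1..d}. \<forall>a\<in>A. (a + s) mod int n \<notin> A" by blast
  next
    assume R: "\<forall>s\<in>c ` {1..d}. \<forall>a\<in>A. (a + s) mod int n \<notin> A"
    show "torus_level d n c A \<in> torus_indep d n"
      unfolding iff
    proof (intro allI ballI impI)
      fix v i assume "i \<in> {1..d}" and "(\<Sum>j\<in>{1..d}. c j * v j) mod int n \<in> A"
      then have "((\<Sum>j\<in>{1..d}. c j * v j) mod int n + c i) mod int n \<notin> A"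
        using R by blast
      then show "((\<Sum>j\<in>{1..d}. c j * v j) + c i) mod int n \<notin> A"
        unfolding mod_add_left_eq .
    qed
  qed
qed

text \<open>Translation by \<open>w\<close> affects a level set only through the value of the form
  at \<open>w\<close> modulo \<open>n\<close>. Hence \<open>w\<close> can be replaced by a multiple
  of e_1, which leaves at most \<open>n\<close> translates.\<close>

lemma torus_level_in_small_indep:
  assumes n: "n \<ge> 2" and d: "d \<ge> 1" and c1: "c 1 = 1" and A: "A \<in> circulant_indep n (c ` {1..d})"
  shows "torus_level d n c A \<in> small_indep d n"
proof -
  have n0: "n > 0" using n by simp
  have one: "1 \<in> {1..d}" using d by simp
  let ?L = "torus_level d n c A"
  have A': "A \<subseteq> {0..<int n}" "A \<noteq> {}" using A by (auto simp: circulant_indep_def)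
  have "?L \<in> torus_indep d n"
    using A torus_level_indep_iff[where c = c, OF n d A'(1) c1] by (simp add: circulant_indep_def)
  moreover have "?L \<noteq> {}"
  proof -
    obtain a where "a \<in> A" using A' by blast
    moreover then have "(c 1 * a) mod int n = a" using A' c1 by auto
    ultimately show ?thesis using torus_red_axis_mem_level_iff[OF n0 one, of a c A] by auto
  qed
  moreover have "card (range (\<lambda>w. torus_shift d n w ?L)) \<le> n"
  proof -
    have "torus_shift d n w ?L = torus_shift d n (axis 1 ((\<Sum>i\<in>{1..d}. c i * w i) mod int n)) ?L" for w
    proof (rule torus_set_eqI[OF n0])
      fix v
      show "torus_red d n v \<in> torus_shift d n w ?L \<longleftrightarrow>
        torus_red d n v \<in> torus_shift d n (axis 1 ((\<Sum>i\<in>{1..d}. c i * w i) mod int n)) ?L"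
        unfolding torus_red_mem_shift_iff[OF n0 torus_level_subset] torus_red_mem_level_iff[OF n0]
        by (simp only: right_diff_distrib sum_subtractf sum_mult_axis[OF one] c1 mod_simps mult_1)
    qed (simp_all add: torus_shift_subset n0 torus_level_subset)
    then have "range (\<lambda>w. torus_shift d n w ?L) \<subseteq> (\<lambda>k. torus_shift d n (axis 1 k) ?L) ` {0..<int n}"
      using n0 by (auto intro!: image_eqI)
    then have "card (range (\<lambda>w. torus_shift d n w ?L)) \<le> card {0..<int n}"
      by (rule surj_card_le[rotated]) simp
    then show ?thesis by simp
  qed
  ultimately show ?thesis by (simp add: small_indep_def)
qed

section \<open>Bijection between small independent sets and pairs of a form and a residue
  set\<close>

lemma ex_inverse_diff_mod_prime:
  fixes k l :: int
  assumes p: "prime p" and "k \<in> {0..<int p}" "l \<in> {0..<int p}" "k \<noteq> l"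
  obtains t where "[(k - l) * t = 1] (mod int p)"
proof -
  have "\<not> [k = l] (mod int p)" using assms by (auto simp: cong_def)
  then have "\<not> int p dvd k - l" by (simp add: cong_iff_dvd_diff)
  then have "coprime (int p) (k - l)" using p by (intro prime_imp_coprime) auto
  then show ?thesis using that cong_solve_coprime_int coprime_commute by metis
qed

text \<open>The set \<open>A\<close> is read off on the first axis, where the normalised forms
  agree. If two coefficients differed, primality would give a vector on which the forms take the
  values \<open>a\<close> and \<open>a + 1\<close> with \<open>a\<close> in \<open>A\<close>;
  equality of the level sets would put both residues in \<open>A\<close>, although
  \<open>c 1 = 1\<close> is a connection.\<close>

lemma inj_on_torus_level:
  assumes p: "prime p" and d: "d \<ge> 1"
  shows "inj_on (\<lambda>(c, A). torus_level d p c A) (SIGMA c:torus_coeffs d p. circulant_indep p (c ` {1..d}))"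
proof -
  have p0: "p > 0" using prime_gt_0_nat[OF p] .
  have one: "1 \<in> {1..d}" using d by simp
  have "c = c' \<and> A = A'" if c: "c \<in> torus_coeffs d p" and c': "c' \<in> torus_coeffs d p"
    and A: "A \<in> circulant_indep p (c ` {1..d})" and A': "A' \<in> circulant_indep p (c' ` {1..d})"
    and eq: "torus_level d p c A = torus_level d p c' A'" for c c' A A'
  proof -
    have c1: "c 1 = 1" "c' 1 = 1" using c c' by (auto simp: torus_coeffs_def)
    have sub: "A \<subseteq> {0..<int p}" "A' \<subseteq> {0..<int p}" using A A' by (auto simp: circulant_indep_def)
    have "k mod int p \<in> A \<longleftrightarrow> k mod int p \<in> A'" for k
      using torus_red_axis_mem_level_iff[OF p0 one] eq c1 by (metis mult_1)
    then have AA: "A = A'" using sub by (metis atLeastLessThan_iff mod_pos_pos_trivial subsetD subsetI subset_antisym)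
    have "c i = c' i" if i: "i \<in> {1..d}" for i
    proof (rule ccontr)
      assume ne: "c i \<noteq> c' i"
      have "c i \<in> {1..<int p}" "c' i \<in> {1..<int p}"
        using c c' i by (auto simp: torus_coeffs_def PiE_iff)
      then obtain t where t: "[(c' i - c i) * t = 1] (mod int p)"
        using ex_inverse_diff_mod_prime[OF p, of "c' i" "c i"] ne by auto
      obtain a where a: "a \<in> A" using A by (auto simp: circulant_indep_def)
      \<comment> \<open>A vector on which the two linear forms take the values \<open>a\<close> and \<open>a + 1\<close> modulo \<open>p\<close>.\<close>
      let ?v = "\<lambda>j. axis 1 (a - c i * t) j + axis i t j"
      have sum: "(\<Sum>j\<in>{1..d}. b j * ?v j) = a + (b i - c i) * t" if "b 1 = 1" for b
        using sum_mult_axis[OF one, of b "a - c i * t"] sum_mult_axis[OF i, of b t] that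
        by (simp only: distrib_left sum.distrib) (simp add: algebra_simps)
      have "a mod int p = a" using a sub by auto
      then have "torus_red d p ?v \<in> torus_level d p c A"
        unfolding torus_red_mem_level_iff[OF p0] sum[where b = c, OF c1(1)] using a by simp
      then have "(a + (c' i - c i) * t) mod int p \<in> A"
        unfolding eq torus_red_mem_level_iff[OF p0] sum[where b = c', OF c1(2)] using AA by simp
      then have "(a + 1) mod int p \<in> A"
        using t by (metis cong_def mod_add_right_eq)
      moreover have "(a + c 1) mod int p \<notin> A"
        using A a imageI[OF one, of c] unfolding circulant_indep_def by blast
      ultimately show False using c1 by simp
    qed
    moreover have "c \<in> extensional {1..d}" "c' \<in> extensional {1..d}"
      using c c' by (auto simp: torus_coeffs_def PiE_def)
    ultimately show ?thesis using AA by (auto intro: extensionalityI)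
  qed
  then show ?thesis by (auto simp: inj_on_def)
qed

text \<open>Once each e_i acts on \<open>I\<close> like \<open>c i\<close> times e_1, translation by
  any \<open>w\<close> acts like the value of the form at \<open>w\<close> times e_1. Membership of
  a vertex in \<open>I\<close> then depends only on the value of the form there.\<close>

lemma small_indep_is_level:
  assumes p: "prime p" and d: "d \<ge> 1" and I: "I \<in> small_indep d p"
  obtains c A where "c \<in> torus_coeffs d p" "A \<in> circulant_indep p (c ` {1..d})" "I = torus_level d p c A"
proof -
  have p0: "p > 0" and p2: "p \<ge> 2" using prime_gt_0_nat[OF p] prime_ge_2_nat[OF p] by auto
  have one: "1 \<in> {1..d}" using d by simp
  have indep: "I \<in> torus_indep d p" and ne: "I \<noteq> {}"
    and card: "card (range (\<lambda>w. torus_shift d p w I)) \<le> p"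
    using I by (auto simp: small_indep_def)
  have sub: "I \<subseteq> torus_verts d p" using indep p2 by (simp add: torus_indep_iff)
  let ?T = "\<lambda>w. torus_shift d p w I"
  have shift_add: "torus_shift d p v (?T w) = ?T (\<lambda>j. v j + w j)" for v w
    by (rule torus_shift_add[OF p0 sub])
  have comm: "torus_shift d p v (?T w) = torus_shift d p w (?T v)" for v w
    unfolding shift_add by (simp only: add.commute)
  have zero: "?T (\<lambda>j. 0) = I" by (rule torus_shift_zero[OF p0 sub])
  obtain x where x: "x \<in> I" using ne by blast
  have red_x: "torus_red d p x = x" using x sub torus_red_id[OF p0] by blast
  \<comment> \<open>The point \<open>x\<close> of \<open>I\<close> and its neighbour x + e_i would
    both lie in \<open>I\<close>.\<close>
  have no_unit: "?T (axis i 1) \<noteq> I" if i: "i \<in> {1..d}" for i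
  proof
    assume eq: "?T (axis i 1) = I"
    have "torus_red d p (x(i := x i + 1)) \<notin> I"
      using torus_indepD[OF p2 indep i, of x] red_x x by simp
    moreover have "torus_red d p (\<lambda>j. (x(i := x i + 1)) j - axis i 1 j) = torus_red d p x"
      by (rule arg_cong[where f = "torus_red d p"]) auto
    then have "torus_red d p (x(i := x i + 1)) \<in> ?T (axis i 1)"
      unfolding torus_red_mem_shift_iff[OF p0 sub] using red_x x by simp
    ultimately show False using eq by simp
  qed
  have mult: "?T (axis i (c * int m)) = ?T (axis 1 (c' * int m))"
    if "?T (axis i c) = ?T (axis 1 c')" for i c c' and m :: nat
  proof (induction m)
    case 0
    have "axis i (c * int 0) = axis 1 (c' * int 0)" by auto
    then show ?case by (simp only:)
  next
    case (Suc m)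
    have "axis i (c * int (Suc m)) = (\<lambda>j. axis i c j + axis i (c * int m) j)"
      by (auto simp: algebra_simps)
    then have "?T (axis i (c * int (Suc m))) = torus_shift d p (axis i c) (?T (axis i (c * int m)))"
      by (simp only: shift_add)
    also have "\<dots> = torus_shift d p (axis 1 (c' * int m)) (?T (axis i c))"
      unfolding Suc by (rule comm)
    also have "\<dots> = ?T (\<lambda>j. axis 1 (c' * int m) j + axis 1 c' j)"
      unfolding that by (rule shift_add)
    also have "(\<lambda>j. axis 1 (c' * int m) j + axis 1 c' j) = axis 1 (c' * int (Suc m))"
      by (auto simp: algebra_simps)
    finally show ?case .
  qed
  \<comment> \<open>A coincidence makes \<open>I\<close> invariant under \<open>k - l\<close> times
    e_1. Multiplying by an inverse of \<open>k - l\<close> modulo \<open>p\<close>, taken as a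
    natural number so that \<open>mult\<close> applies, gives invariance under e_1, contrary to
    \<open>no_unit\<close>.\<close>
  have inj: "inj_on (\<lambda>k. ?T (axis 1 k)) {0..<int p}"
  proof (rule inj_onI, rule ccontr)
    fix k l assume kl: "k \<in> {0..<int p}" "l \<in> {0..<int p}" "?T (axis 1 k) = ?T (axis 1 l)" "k \<noteq> l"
    then obtain t where t: "[(k - l) * t = 1] (mod int p)"
      using ex_inverse_diff_mod_prime[OF p] by blast
    define m where "m = nat (t mod int p)"
    have m: "[(k - l) * int m = 1] (mod int p)"
      using t p0 by (simp add: m_def cong_def mod_mult_right_eq)
    have "(\<lambda>j. axis 1 (- l) j + axis 1 k j) = axis 1 (k - l)" 
         "(\<lambda>j. axis 1 (- l) j + axis 1 l j) = (\<lambda>j. 0)" by auto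
    then have "?T (axis 1 (k - l)) = ?T (axis 1 0)"
      using shift_add[of "axis 1 (-l)" "axis 1 k"] shift_add[of "axis 1 (-l)" "axis 1 l"] kl(3) by simp
    from mult[OF this, of m] have "?T (axis 1 ((k - l) * int m)) = ?T (axis 1 (0 * int m))" .
    also have "axis 1 (0 * int m) = (\<lambda>j. 0)" by auto
    also note zero
    finally have "?T (axis 1 ((k - l) * int m)) = I" .
    moreover have "?T (axis 1 ((k - l) * int m)) = ?T (axis 1 1)"
      using m by (intro torus_shift_cong) auto
    ultimately show False using no_unit[OF one] by simp
  qed
  have fin: "finite (range ?T)"
    by (rule finite_subset[of _ "torus_indep d p"])
      (use torus_shift_indep[OF p2 indep] finite_torus_indep[OF p0] in auto)
  \<comment> \<open>These are \<open>p\<close> distinct members of an orbit with at most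
    \<open>p\<close> members.\<close>
  have "(\<lambda>k. ?T (axis 1 k)) ` {0..<int p} = range ?T"
    by (rule card_seteq[OF fin]) (use card card_image[OF inj] in auto)
  then have "\<exists>k\<in>{0..<int p}. ?T w = ?T (axis 1 k)" for w by blast
  then obtain f where f: "f w \<in> {0..<int p}" "?T w = ?T (axis 1 (f w))" for w by metis
  define c where "c = (\<lambda>i\<in>{1..d}. f (axis i 1))"
  have c_app: "c i = f (axis i 1)" if "i \<in> {1..d}" for i
    using that by (simp add: c_def)
  have c_eq: "?T (axis i 1) = ?T (axis 1 (c i))" if "i \<in> {1..d}" for i
    unfolding c_app[OF that] by (rule f(2))
  have c_range: "c i \<in> {0..<int p}" if "i \<in> {1..d}" for i
    unfolding c_app[OF that] by (rule f(1))
  have c1: "c 1 = 1"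
    using inj_onD[OF inj c_eq[OF one] _ c_range[OF one]] p2 by simp
  have "c i \<in> {1..<int p}" if i: "i \<in> {1..d}" for i
  proof -
    have "c i \<noteq> 0"
    proof
      assume "c i = 0"
      then have "axis 1 (c i) = (\<lambda>j. 0)" by auto
      then show False using c_eq[OF i] no_unit[OF i] zero by simp
    qed
    then show ?thesis using c_range[OF i] by auto
  qed
  then have c: "c \<in> torus_coeffs d p" using c1 by (auto simp: torus_coeffs_def c_def)
  \<comment> \<open>Induction over the coordinates, moving one at a time to the first axis.
    Nonnegative entries are required because \<open>mult\<close> handles natural multiples
    only.\<close>
  have shift_sum: "?T (\<lambda>j. if j \<in> S then w j else 0) = ?T (axis 1 (\<Sum>i\<in>S. c i * w i))"
    if "finite S" "S \<subseteq> {1..d}" and w: "\<And>j. w j \<ge> 0" for S w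
    using that(1,2)
  proof (induction S)
    case empty
    then show ?case by (simp cong: if_cong)
  next
    case (insert i S)
    have i: "i \<in> {1..d}" using insert by simp
    have "(\<lambda>j. if j \<in> insert i S then w j else 0) =
      (\<lambda>j. axis i (w i) j + (if j \<in> S then w j else 0))"
      using insert by auto
    then have "?T (\<lambda>j. if j \<in> insert i S then w j else 0) =
      torus_shift d p (axis i (w i)) (?T (\<lambda>j. if j \<in> S then w j else 0))"
      by (simp only: shift_add)
    also have "?T (\<lambda>j. if j \<in> S then w j else 0) = ?T (axis 1 (\<Sum>i\<in>S. c i * w i))"
      using insert by simp
    also have "torus_shift d p (axis i (w i)) \<dots> =
      torus_shift d p (axis 1 (\<Sum>i\<in>S. c i * w i)) (?T (axis i (w i)))"
      by (rule comm)
    also have "?T (axis i (w i)) = ?T (axis 1 (c i * w i))"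
      using mult[OF c_eq[OF i], of "nat (w i)"] unfolding nat_0_le[OF w] mult_1 .
    also have "torus_shift d p (axis 1 (\<Sum>i\<in>S. c i * w i)) \<dots> =
      ?T (\<lambda>j. axis 1 (\<Sum>i\<in>S. c i * w i) j + axis 1 (c i * w i) j)"
      by (rule shift_add)
    also have "(\<lambda>j. axis 1 (\<Sum>i\<in>S. c i * w i) j + axis 1 (c i * w i) j) =
      axis 1 (\<Sum>i\<in>insert i S. c i * w i)"
      using insert by auto
    finally show ?case .
  qed
  have mem: "torus_red d p v \<in> I \<longleftrightarrow> torus_red d p (axis 1 (\<Sum>i\<in>{1..d}. c i * v i)) \<in> I" for v
  proof -
    \<comment> \<open>Membership of \<open>v\<close> in \<open>I\<close> is membership of 0 in the
      translate by \<open>-v\<close>; \<open>?w\<close> represents \<open>-v\<close> by nonnegative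
      entries, as \<open>shift_sum\<close> demands.\<close>
    let ?w = "\<lambda>j. (- v j) mod int p"
    have "torus_red d p v \<in> I \<longleftrightarrow> torus_red d p (\<lambda>j. 0) \<in> ?T (\<lambda>j. - v j)"
      by (simp add: torus_red_mem_shift_iff[OF p0 sub])
    also have "?T (\<lambda>j. - v j) = ?T (\<lambda>j. if j \<in> {1..d} then ?w j else 0)"
      by (intro torus_shift_cong) (simp add: cong_def)
    also have "\<dots> = ?T (axis 1 (\<Sum>i\<in>{1..d}. c i * ?w i))"
      using p0 by (intro shift_sum) auto
    also have "\<dots> = ?T (axis 1 (- (\<Sum>i\<in>{1..d}. c i * v i)))"
    proof (rule torus_shift_cong)
      have "[\<Sum>i\<in>{1..d}. c i * ?w i = \<Sum>i\<in>{1..d}. c i * (- v i)] (mod int p)"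
        by (intro cong_sum cong_mult) (auto simp: cong_def)
      then show "[axis 1 (\<Sum>i\<in>{1..d}. c i * ?w i) j = axis 1 (- (\<Sum>i\<in>{1..d}. c i * v i)) j] (mod int p)" for j
        by (simp add: sum_negf)
    qed
    also have "torus_red d p (\<lambda>j. 0) \<in> \<dots> \<longleftrightarrow> torus_red d p (axis 1 (\<Sum>i\<in>{1..d}. c i * v i)) \<in> I"
      unfolding torus_red_mem_shift_iff[OF p0 sub]
      by (intro arg_cong[where f = "\<lambda>x. x \<in> I"] arg_cong[where f = "torus_red d p"]) auto
    finally show ?thesis .
  qed
  define A where "A = {k \<in> {0..<int p}. torus_red d p (axis 1 k) \<in> I}"
  have A: "A \<subseteq> {0..<int p}" by (auto simp: A_def)
  have IL: "I = torus_level d p c A"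
  proof (rule torus_set_eqI[OF p0 sub torus_level_subset])
    fix v
    let ?s = "\<Sum>i\<in>{1..d}. c i * v i"
    have "torus_red d p (axis 1 ?s) = torus_red d p (axis 1 (?s mod int p))"
      by (intro torus_red_eqI) (simp add: cong_def)
    then show "torus_red d p v \<in> I \<longleftrightarrow> torus_red d p v \<in> torus_level d p c A"
      unfolding torus_red_mem_level_iff[OF p0] mem[of v] using p0 by (simp add: A_def del: One_nat_def)
  qed
  moreover have "A \<in> circulant_indep p (c ` {1..d})"
    using indep A torus_level_indep_iff[where c = c, OF p2 d A c1] ne
    unfolding IL circulant_indep_def by (auto simp: torus_level_def)
  ultimately show ?thesis using c that by blast
qed

lemma card_small_indep:
  assumes p: "prime p" and d: "d \<ge> 1"
  shows "card (small_indep d p) = (\<Sum>c\<in>torus_coeffs d p. card (circulant_indep p (c ` {1..d})))"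
proof -
  let ?D = "SIGMA c:torus_coeffs d p. circulant_indep p (c ` {1..d})"
  have p2: "p \<ge> 2" using prime_ge_2_nat[OF p] .
  have "(\<lambda>(c, A). torus_level d p c A) ` ?D \<subseteq> small_indep d p"
    using torus_level_in_small_indep[OF p2 d] by (auto simp: torus_coeffs_def simp del: One_nat_def)
  moreover have "small_indep d p \<subseteq> (\<lambda>(c, A). torus_level d p c A) ` ?D"
    by (rule subsetI, erule small_indep_is_level[OF p d]) (rule image_eqI, auto)
  ultimately have "(\<lambda>(c, A). torus_level d p c A) ` ?D = small_indep d p" by blast
  then have "card (small_indep d p) = card ?D"
    using card_image[OF inj_on_torus_level[OF p d]] by metis
  also have "finite (torus_coeffs d p)"
    by (rule finite_subset[of _ "{1..d} \<rightarrow>\<^sub>E {1..<int p}"]) (auto simp: torus_coeffs_def intro: finite_PiE)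
  moreover have "finite (circulant_indep p S)" for S
    by (rule finite_subset[of _ "Pow {0..<int p}"]) (auto simp: circulant_indep_def)
  ultimately show ?thesis by (simp add: card_SigmaI)
qed

section \<open>Circulant graphs on five vertices\<close>

text \<open>Modulo \<open>n\<close>, adding \<open>int n - s\<close> undoes adding \<open>s\<close>,
  so both conditions forbid the same pairs of residues.\<close>

lemma circulant_indep_negate:
  assumes A: "A \<subseteq> {0..<int n}"
  shows "(\<forall>a\<in>A. (a + (int n - s)) mod int n \<notin> A) \<longleftrightarrow> (\<forall>a\<in>A. (a + s) mod int n \<notin> A)"
proof -
  have *: "((a + s) mod int n + (int n - s)) mod int n = a" 
    "((a + (int n - s)) mod int n + s) mod int n = a" if "a \<in> A" for a
    using A that by (auto simp: mod_simps)
  then show ?thesis by metis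
qed

text \<open>As 4 is -1 modulo 5, the graph is the 5-cycle: five singletons and five nonadjacent
  pairs.\<close>

lemma card_circulant_indep_cycle:
  assumes "1 \<in> S" "S \<subseteq> {1, 4}"
  shows "card (circulant_indep 5 S) = 10"
proof -
  have "circulant_indep 5 S = {A \<in> Pow {0..<5}. A \<noteq> {} \<and> (\<forall>a\<in>A. (a + 1) mod 5 \<notin> A)}"
    using assms circulant_indep_negate[of _ 5 1] by (auto simp: circulant_indep_def)
  also have "{0..<5::int} = {0, 1, 2, 3, 4}" by auto
  also have "{A \<in> Pow {0, 1, 2, 3, 4}. A \<noteq> {} \<and> (\<forall>a\<in>A. (a + 1) mod 5 \<notin> A)} =
    {{0}, {1}, {2}, {3}, {4}, {0, 2}, {1, 3}, {2, 4}, {0, 3}, {1, 4::int}}" (is "?L = ?R")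
  proof
    show "?L \<subseteq> ?R"
    proof
      fix A assume "A \<in> ?L"
      then have "A \<in> Pow {0, 1, 2, 3, 4}" and "A \<noteq> {}" and "\<forall>a\<in>A. (a + 1) mod 5 \<notin> A" by auto
      then show "A \<in> ?R"
        unfolding Pow_insert by (simp, elim disjE) (simp_all add: insert_commute)
    qed
  qed simp
  also have "card \<dots> = 10" by (simp add: doubleton_eq_iff)
  finally show ?thesis .
qed

text \<open>Besides 1 there is a connection 2 or 3, that is 2 up to sign, so all nonzero differences
  are forbidden and only singletons remain.\<close>

lemma card_circulant_indep_complete:
  assumes "1 \<in> S" "S \<subseteq> {1..<5}" "\<not> S \<subseteq> {1, 4}"
  shows "card (circulant_indep 5 S) = 5"
proof -
  obtain t where t1: "t \<in> S" "t \<noteq> 1" "t \<noteq> 4" using assms(3) by blast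
  \<comment> \<open>The value 3 is written \<open>5 - 2\<close> to match
    \<open>circulant_indep_negate\<close>.\<close>
  then have t: "t \<in> S" "t = 2 \<or> t = 5 - 2" using subsetD[OF assms(2) t1(1)] by auto
  have "circulant_indep 5 S = (\<lambda>a. {a}) ` {0..<5}"
  proof
    show "circulant_indep 5 S \<subseteq> (\<lambda>a. {a}) ` {0..<5}"
    proof
      fix A assume A: "A \<in> circulant_indep 5 S"
      then have sub: "A \<subseteq> {0..<int 5}" and 1: "\<forall>a\<in>A. (a + 1) mod 5 \<notin> A"
        and "\<forall>a\<in>A. (a + t) mod 5 \<notin> A"
        using assms t by (auto simp: circulant_indep_def)
      then have 2: "\<forall>a\<in>A. (a + 2) mod 5 \<notin> A"
        using t circulant_indep_negate[OF sub, of 2] by auto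
      have 3: "\<forall>a\<in>A. (a + 3) mod 5 \<notin> A" and 4: "\<forall>a\<in>A. (a + 4) mod 5 \<notin> A"
        using 1 2 circulant_indep_negate[OF sub, of 2] circulant_indep_negate[OF sub, of 1] by auto
      have "a = b" if ab: "a \<in> A" "b \<in> A" for a b
      proof (rule ccontr)
        assume "a \<noteq> b"
        moreover have "a \<in> {0, 1, 2, 3, 4}" "b \<in> {0, 1, 2, 3, 4}" using subsetD[OF sub] ab by force+
        ultimately have "\<exists>s\<in>{1, 2, 3, 4}. b = (a + s) mod 5" by auto
        then show False using 1 2 3 4 ab by auto
      qed
      moreover obtain a where "a \<in> A" using A by (auto simp: circulant_indep_def)
      ultimately have "A = {a}" "a \<in> {0..<5}" using sub by auto
      then show "A \<in> (\<lambda>a. {a}) ` {0..<5}" by blast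
    qed
    have "(a + s) mod 5 \<noteq> a" if "a \<in> {0..<5}" "s \<in> S" for a s
    proof -
      have "\<not> [a + s = a] (mod 5)"
        using subsetD[OF assms(2) that(2)] by (auto simp: cong_iff_dvd_diff zdvd_not_zless)
      then show ?thesis using that(1) by (auto simp: cong_def)
    qed
    then show "(\<lambda>a. {a}) ` {0..<5} \<subseteq> circulant_indep 5 S"
      by (auto simp: circulant_indep_def)
  qed
  then show ?thesis by (simp add: card_image)
qed

section \<open>Counting coefficient tuples for the prime 5\<close>

text \<open>The condition on \<open>c 1\<close> is absorbed into a dependent product whose first
  factor is a singleton, leaving \<open>d - 1\<close> free coordinates.\<close>

lemma card_PiE_first_fixed:
  assumes "d \<ge> 1"
  shows "card {c \<in> {1..d} \<rightarrow>\<^sub>E insert 1 T. c 1 = (1::int)} = card (insert 1 T) ^ (d - 1)"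
proof -
  have PiE: "{c \<in> {1..d} \<rightarrow>\<^sub>E insert 1 T. c 1 = 1} = (\<Pi>\<^sub>E i\<in>{1..d}. if i = 1 then {1} else insert 1 T)"
    using assms by (auto simp: PiE_iff extensional_def split: if_splits)
  have "{1..d} = insert 1 {2..d}" using assms by auto
  moreover have "(\<Prod>i\<in>{2..d}. card (if i = 1 then {1} else insert 1 T)) = card (insert 1 T) ^ (d - 1)"
    by (subst prod.cong[OF refl, of _ _ "\<lambda>_. card (insert 1 T)"]) auto
  ultimately have "(\<Prod>i\<in>{1..d}. card (if i = 1 then {1} else insert 1 T)) = card (insert 1 T) ^ (d - 1)"
    by (simp del: One_nat_def)
  with PiE show ?thesis by (simp only: card_PiE finite_atLeastAtMost)
qed

text \<open>Every tuple contributes 5, and those with all entries in {1, 4} contribute 5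
  more.\<close>

lemma card_small_indep_5:
  assumes d: "d \<ge> 1"
  shows "card (small_indep d 5) = 5 * (2 ^ (d - 1) + 4 ^ (d - 1))"
proof -
  let ?C = "torus_coeffs d 5"
  let ?C' = "{c \<in> ?C. c ` {1..d} \<subseteq> {1, 4}}"
  have one: "1 \<in> {1..d}" using d by simp
  have C: "?C = {c \<in> {1..d} \<rightarrow>\<^sub>E insert 1 {2, 3, 4}. c 1 = 1}"
  proof -
    have "{1..<int 5} = insert 1 {2, 3, 4}" by auto
    then show ?thesis by (simp only: torus_coeffs_def)
  qed
  then have C': "?C' = {c \<in> {1..d} \<rightarrow>\<^sub>E insert 1 {4}. c 1 = 1}"
    by (auto simp: PiE_iff image_subset_iff)
  have "card ?C = card (insert 1 {2, 3, 4::int}) ^ (d - 1)"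
    unfolding C by (rule card_PiE_first_fixed[OF d])
  also have "card (insert 1 {2, 3, 4::int}) = 4" by simp
  finally have card_C: "card ?C = 4 ^ (d - 1)" .
  have "card ?C' = card (insert 1 {4::int}) ^ (d - 1)"
    unfolding C' by (rule card_PiE_first_fixed[OF d])
  also have "card (insert 1 {4::int}) = 2" by simp
  finally have card_C': "card ?C' = 2 ^ (d - 1)" .
  have fin: "finite ?C"
    unfolding C
    by (rule finite_subset[of _ "{1..d} \<rightarrow>\<^sub>E insert 1 {2, 3, 4}"])
      (auto intro!: finite_PiE simp del: One_nat_def)
  have "card (circulant_indep 5 (c ` {1..d})) = 5 + (if c ` {1..d} \<subseteq> {1, 4} then 5 else 0)"
    if "c \<in> ?C" for c
  proof -
    have "1 \<in> c ` {1..d}" "c ` {1..d} \<subseteq> {1..<5}"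
      using that imageI[OF one, of c] by (auto simp: torus_coeffs_def PiE_iff)
    then show ?thesis using card_circulant_indep_cycle card_circulant_indep_complete by simp
  qed
  then have "card (small_indep d 5) = (\<Sum>c\<in>?C. 5 + (if c ` {1..d} \<subseteq> {1, 4} then 5 else 0))"
    using card_small_indep[of 5 d] d by simp
  also have "\<dots> = 5 * card ?C + 5 * card ?C'"
    using fin by (simp add: sum.distrib sum.inter_filter[symmetric])
  finally show ?thesis by (simp only: card_C card_C' distrib_left add.commute)
qed

section \<open>The 5-adic valuation\<close>

text \<open>Both fourth powers are 1 modulo 5, so only \<open>m mod 4\<close> matters. The
  remainders 0, 1, 2, 3 give the sums 2, 6, 20, 72.\<close>

lemma five_dvd_power_sum_iff: "(5::int) dvd 2 ^ m + 4 ^ m \<longleftrightarrow> m mod 4 = 2"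
proof -
  define q r where "q = m div 4" and "r = m mod 4"
  have m: "m = 4 * q + r" and r: "r < 4" by (simp_all add: q_def r_def)
  have "[(2::int) ^ 4 = 1] (mod 5)" "[(4::int) ^ 4 = 1] (mod 5)" by (simp_all add: cong_def)
  then have "[((2::int) ^ 4) ^ q * 2 ^ r + (4 ^ 4) ^ q * 4 ^ r = 1 ^ q * 2 ^ r + 1 ^ q * 4 ^ r] (mod 5)"
    by (intro cong_add cong_mult cong_pow cong_refl)
  then have "[(2::int) ^ m + 4 ^ m = 2 ^ r + 4 ^ r] (mod 5)"
    by (simp add: m power_add power_mult)
  then have "(5::int) dvd 2 ^ m + 4 ^ m \<longleftrightarrow> (5::int) dvd 2 ^ r + 4 ^ r"
    by (rule cong_dvd_iff)
  also have "\<dots> \<longleftrightarrow> r = 2"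
  proof -
    have "r \<in> {0, 1, 2, 3}" using r by auto
    then show ?thesis by auto
  qed
  finally show ?thesis by (simp add: r_def)
qed

lemma multiplicity_eq_1_iff:
  fixes p x :: int
  assumes "prime p"
  shows "multiplicity p x = 1 \<longleftrightarrow> p dvd x \<and> \<not> p\<^sup>2 dvd x"
\<comment> \<open>For \<open>x = 0\<close> both sides fail: \<open>multiplicity p 0\<close> is 0,
  and the square of \<open>p\<close> divides 0.\<close>
proof (cases "x = 0")
  case False
  have "\<not> is_unit p" using assms by auto
  then have "p ^ k dvd x \<longleftrightarrow> k \<le> multiplicity p x" for k
    using False by (intro power_dvd_iff_le_multiplicity) auto
  from this[of 1] this[of 2] show ?thesis by auto
qed simp

theorem proposition3p25:
  fixes d :: nat
  assumes "d \<ge> 1"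
  shows "[num_indep d 5 = 1 + 5 * (2 ^ (d - 1) + 4 ^ (d - 1))] (mod 25)
       \<and> (multiplicity (5::int) (int (num_indep d 5) - 1) = 1 \<longleftrightarrow> \<not> [d = 3] (mod 4))"
proof
  let ?s = "2 ^ (d - 1) + 4 ^ (d - 1) :: int"
  show main: "[num_indep d 5 = 1 + 5 * (2 ^ (d - 1) + 4 ^ (d - 1))] (mod 25)"
    using num_indep_cong_small_indep[of 5 d] by (simp add: card_small_indep_5[OF assms])
  then have "[int (num_indep d 5) = int (1 + 5 * (2 ^ (d - 1) + 4 ^ (d - 1)))] (mod int 25)"
    by (simp only: cong_int_iff)
  then have "[int (num_indep d 5) = 1 + 5 * ?s] (mod 25)" by simp
  then have "[int (num_indep d 5) - 1 = 1 + 5 * ?s - 1] (mod 25)"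
    by (intro cong_diff cong_refl)
  then have *: "[int (num_indep d 5) - 1 = 5 * ?s] (mod 25)" by simp
  then have "[int (num_indep d 5) - 1 = 5 * ?s] (mod 5)"
    by (rule cong_dvd_modulus) simp
  then have "5 dvd int (num_indep d 5) - 1"
    by (simp add: cong_dvd_iff)
  \<comment> \<open>Cancelling one factor 5 leaves the divisibility of the power sum to decide about
    the second.\<close>
  moreover have "5\<^sup>2 dvd int (num_indep d 5) - 1 \<longleftrightarrow> 5 dvd ?s"
    using cong_dvd_iff[OF *] dvd_mult_cancel_left[of 5 5 ?s] by simp
  moreover have "multiplicity 5 (int (num_indep d 5) - 1) = 1 \<longleftrightarrow>
      5 dvd int (num_indep d 5) - 1 \<and> \<not> 5\<^sup>2 dvd int (num_indep d 5) - 1"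
    by (rule multiplicity_eq_1_iff) simp
  ultimately have "multiplicity 5 (int (num_indep d 5) - 1) = 1 \<longleftrightarrow> (d - 1) mod 4 \<noteq> 2"
    by (simp only: five_dvd_power_sum_iff simp_thms)
  \<comment> \<open>The exponent is \<open>d - 1\<close>, so its remainder 2 corresponds to
    remainder 3 of \<open>d\<close>; \<open>d \<ge> 1\<close> rules out truncated
    subtraction.\<close>
  also have "\<dots> \<longleftrightarrow> \<not> [d = 3] (mod 4)"
    using assms by (cases d) (auto simp: cong_def mod_Suc)
  finally show "multiplicity (5::int) (int (num_indep d 5) - 1) = 1 \<longleftrightarrow> \<not> [d = 3] (mod 4)" .
qed

end
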